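(* Let $\mathbb V$ be a Schubert representation of $\widehat H_n$ with evaluation map $\operatorname{ev}$. For $\mu,\nu\subseteq(n-k)^k$, $\operatorname{ev}(\overline T_\mu\cdot\mathcal Y_\nu)=\operatorname{ev}(\mathcal Y_{\mathrm{id}})$ if $\mu=\nu$ and $=0$ otherwise. Moreover, for every $\mathbb F$-linear combination $f$ of the $\mathcal Y_\lambda$ ($\lambda\subseteq(n-k)^k$), $$f=\frac1{\operatorname{ev}(\mathcal Y_{\mathrm{id}})}\sum_{\lambda\subseteq(n-k)^k}\operatorname{ev}(\overline T_\lambda\cdot f)\,\mathcal Y_\lambda.$$
   Context: $\mathcal A_\hbar=\mathbb Q[p,q,\hbar]$; $\widehat H_n$ is generated over $\mathcal A_\hbar$ by $T_1,\dots,T_{n-1},x_1,\dots,x_n$ with relations $(T_i+p)(T_i-q)=0$, braid relations, $x_ix_j=x_jx_i$, $T_ix_j=x_jT_i$ ($j\ne i,i+1$), $T_ix_i=x_{i+1}T_i+(\hbar-(p-q)x_i)$, $T_ix_{i+1}=x_iT_i-(\hbar-(p-q)x_i)$; $T_w,\overline T_w$ via reduced words with $\overline T_i=T_i+p-q$. Schubert representation: field $\mathbb F$ with $t_1,\dots,t_n$, ring map $\mathcal A_\hbar\to\mathbb F$, $\mathbb F$-space $\mathbb V$ with $\widehat H_n$-action, basis $\mathcal Y_w=T_{w^{-1}w_0}\mathcal Y_{w_0}$, $\mathbb F$-linear $\operatorname{ev}$ with $\operatorname{ev}(\mathcal Y_w)\ne0\iff w=\mathrm{id}$ and $\operatorname{ev}(x_i\mathcal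 Y_w)=t_i\operatorname{ev}(\mathcal Y_w)$. For $\lambda\subseteq(n-k)^k$, $w_\lambda$ is the Grassmannian permutation with $w_\lambda(k+1-i)=\lambda_i+k+1-i$ ($1\le i\le k$), increasing on $\{k+1,\dots,n\}$. $[m]=(p^m-q^m)/(p-q)$, $[m]!=\prod_{j\le m}[j]$, $d=\binom k2+\binom{n-k}2$, $\Sigma^n_k=\frac1{[k]![n-k]!}\sum_{v\in S_k\times S_{n-k}}q^{d-\ell(v)}\overline T_v$, $\overline T_\lambda=\overline T_{w_\lambda}\Sigma^n_k$, $\mathcal Y_\lambda=\sum_{v\in S_k\times S_{n-k}}p^{\ell(v)}\mathcal Y_{w_\lambda v}$ (the quantities $[k]![n-k]!$ are assumed invertible in $\mathbb F$). *)

theory Defs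
  imports "HOL-Combinatorics.Combinatorics"
begin

text \<open>Permutations of {1..n} are functions nat => nat (fixing everything outside {1..n});
  products are function compositions, (w v)(j) = w (v j).\<close>

definition inv_count :: "nat \<Rightarrow> (nat \<Rightarrow> nat) \<Rightarrow> nat" where
  "inv_count n w = card {(i, j). 1 \<le> i \<and> i < j \<and> j \<le> n \<and> w j < w i}"

definition sref :: "nat \<Rightarrow> nat \<Rightarrow> nat" where
  "sref i = transpose i (Suc i)"

definition word_perm :: "nat list \<Rightarrow> nat \<Rightarrow> nat" where
  "word_perm ws = foldr (\<lambda>i w. sref i \<circ> w) ws id"

definition reduced_word :: "nat \<Rightarrow> (nat \<Rightarrow> nat) \<Rightarrow> nat list \<Rightarrow> bool" where
  "reduced_word n w ws \<longleftrightarrow> set ws \<subseteq> {1..<n} \<and> length ws = inv_count n w \<and> word_perm ws = w"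

definition word_op :: "(nat \<Rightarrow> 'v \<Rightarrow> 'v) \<Rightarrow> nat list \<Rightarrow> 'v \<Rightarrow> 'v" where
  "word_op T ws = foldr (\<lambda>i g. T i \<circ> g) ws id"

definition perm_op :: "nat \<Rightarrow> (nat \<Rightarrow> 'v \<Rightarrow> 'v) \<Rightarrow> (nat \<Rightarrow> nat) \<Rightarrow> 'v \<Rightarrow> 'v" where
  "perm_op n T w = word_op T (SOME ws. reduced_word n w ws)"

definition Tbar_gen :: "('f::field \<Rightarrow> 'v \<Rightarrow> 'v::ab_group_add) \<Rightarrow> 'f \<Rightarrow> 'f \<Rightarrow> (nat \<Rightarrow> 'v \<Rightarrow> 'v) \<Rightarrow> nat \<Rightarrow> 'v \<Rightarrow> 'v" where
  "Tbar_gen scale p q T i v = T i v + scale (p - q) v"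

text \<open>[m] = (p^m - q^m)/(p - q), written as the polynomial it is.\<close>
definition qint :: "'f::field \<Rightarrow> 'f \<Rightarrow> nat \<Rightarrow> 'f" where
  "qint p q m = (\<Sum>j<m. p ^ j * q ^ (m - 1 - j))"

definition qfact :: "'f::field \<Rightarrow> 'f \<Rightarrow> nat \<Rightarrow> 'f" where
  "qfact p q m = (\<Prod>j\<in>{1..m}. qint p q j)"

definition w0 :: "nat \<Rightarrow> nat \<Rightarrow> nat" where
  "w0 n j = (if 1 \<le> j \<and> j \<le> n then n + 1 - j else j)"

text \<open>Partitions \<open>\<lambda> \<subseteq> (n-k)^k\<close>: \<open>\<lambda> i\<close> is the i-th part (1 <= i <= k), zero elsewhere.\<close>
definition young_box :: "nat \<Rightarrow> nat \<Rightarrow> (nat \<Rightarrow> nat) set" where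
  "young_box k n = {la. (\<forall>i. (i = 0 \<or> k < i) \<longrightarrow> la i = 0)
      \<and> (\<forall>i. 1 \<le> i \<longrightarrow> la (Suc i) \<le> la i) \<and> (\<forall>i. la i \<le> n - k)}"

definition grass_perm :: "nat \<Rightarrow> nat \<Rightarrow> (nat \<Rightarrow> nat) \<Rightarrow> nat \<Rightarrow> nat" where
  "grass_perm n k la = (THE w. w permutes {1..n} \<and> (\<forall>j\<in>{1..k}. w j = la (k + 1 - j) + j)
      \<and> strict_mono_on {k+1..n} w)"

definition parabolic :: "nat \<Rightarrow> nat \<Rightarrow> (nat \<Rightarrow> nat) set" where
  "parabolic n k = {v. v permutes {1..n} \<and> v ` {1..k} = {1..k}}"

definition Sigma_op :: "('f::field \<Rightarrow> 'v \<Rightarrow> 'v::ab_group_add) \<Rightarrow> 'f \<Rightarrow> 'f \<Rightarrow> nat \<Rightarrow> nat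
    \<Rightarrow> (nat \<Rightarrow> 'v \<Rightarrow> 'v) \<Rightarrow> 'v \<Rightarrow> 'v" where
  "Sigma_op scale p q n k T v =
     scale (inverse (qfact p q k * qfact p q (n - k)))
       (\<Sum>u\<in>parabolic n k. scale (q ^ ((k choose 2) + ((n - k) choose 2) - inv_count n u))
           (perm_op n (Tbar_gen scale p q T) u v))"

definition Tbar_lambda :: "('f::field \<Rightarrow> 'v \<Rightarrow> 'v::ab_group_add) \<Rightarrow> 'f \<Rightarrow> 'f \<Rightarrow> nat \<Rightarrow> nat
    \<Rightarrow> (nat \<Rightarrow> 'v \<Rightarrow> 'v) \<Rightarrow> (nat \<Rightarrow> nat) \<Rightarrow> 'v \<Rightarrow> 'v" where
  "Tbar_lambda scale p q n k T la v =
     perm_op n (Tbar_gen scale p q T) (grass_perm n k la) (Sigma_op scale p q n k T v)"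

definition Y_lambda :: "('f::field \<Rightarrow> 'v \<Rightarrow> 'v::ab_group_add) \<Rightarrow> 'f \<Rightarrow> nat \<Rightarrow> nat
    \<Rightarrow> ((nat \<Rightarrow> nat) \<Rightarrow> 'v) \<Rightarrow> (nat \<Rightarrow> nat) \<Rightarrow> 'v" where
  "Y_lambda scale p n k Y la = (\<Sum>u\<in>parabolic n k. scale (p ^ inv_count n u) (Y (grass_perm n k la \<circ> u)))"

text \<open>A Schubert representation: F is a field of characteristic 0 (it receives a ring map from
  Q[p,q,hbar]; p, q, hb are the images of p, q, hbar), V is an F-vector space with
  operators T_i (1<=i<n), x_i (1<=i<=n) satisfying the defining relations of the affine Hecke algebra.\<close>
definition schubert_rep ::
  "('f::field_char_0 \<Rightarrow> 'v \<Rightarrow> 'v::ab_group_add) \<Rightarrow> nat \<Rightarrow> 'f \<Rightarrow> 'f \<Rightarrow> 'f \<Rightarrow> (nat \<Rightarrow> 'f)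
   \<Rightarrow> (nat \<Rightarrow> 'v \<Rightarrow> 'v) \<Rightarrow> (nat \<Rightarrow> 'v \<Rightarrow> 'v) \<Rightarrow> ((nat \<Rightarrow> nat) \<Rightarrow> 'v) \<Rightarrow> ('v \<Rightarrow> 'f) \<Rightarrow> bool" where
  "schubert_rep scale n p q hb t T x Y ev \<longleftrightarrow>
     vector_space scale
   \<and> (\<forall>i\<in>{1..<n}. Vector_Spaces.linear scale scale (T i))
   \<and> (\<forall>i\<in>{1..n}. Vector_Spaces.linear scale scale (x i))
   \<and> (\<forall>i\<in>{1..<n}. \<forall>v. T i (T i v) + scale (p - q) (T i v) - scale (p * q) v = 0)
   \<and> (\<forall>i\<in>{1..<n}. \<forall>j\<in>{1..<n}. (i + 1 < j \<or> j + 1 < i) \<longrightarrow> (\<forall>v. T i (T j v) = T j (T i v)))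
   \<and> (\<forall>i. 1 \<le> i \<and> i + 1 < n \<longrightarrow> (\<forall>v. T i (T (i+1) (T i v)) = T (i+1) (T i (T (i+1) v))))
   \<and> (\<forall>i\<in>{1..n}. \<forall>j\<in>{1..n}. \<forall>v. x i (x j v) = x j (x i v))
   \<and> (\<forall>i\<in>{1..<n}. \<forall>j\<in>{1..n}. j \<noteq> i \<and> j \<noteq> i + 1 \<longrightarrow> (\<forall>v. T i (x j v) = x j (T i v)))
   \<and> (\<forall>i\<in>{1..<n}. \<forall>v. T i (x i v) = x (i+1) (T i v) + (scale hb v - scale (p - q) (x i v)))
   \<and> (\<forall>i\<in>{1..<n}. \<forall>v. T i (x (i+1) v) = x i (T i v) - (scale hb v - scale (p - q) (x i v)))
   \<and> inj_on Y {w. w permutes {1..n}}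
   \<and> \<not> module.dependent scale (Y ` {w. w permutes {1..n}})
   \<and> module.span scale (Y ` {w. w permutes {1..n}}) = UNIV
   \<and> (\<forall>w. w permutes {1..n} \<longrightarrow> Y w = perm_op n T (inv w \<circ> w0 n) (Y (w0 n)))
   \<and> Vector_Spaces.linear scale (*) ev
   \<and> (\<forall>w. w permutes {1..n} \<longrightarrow> (ev (Y w) \<noteq> 0 \<longleftrightarrow> w = id))
   \<and> (\<forall>i\<in>{1..n}. \<forall>w. w permutes {1..n} \<longrightarrow> ev (x i (Y w)) = t i * ev (Y w))"

end

theory Submission
  imports Defs
begin

text \<open>
  Write \<open>s\<^sub>i\<close> for the simple reflections. Matsumoto's theorem gives \<open>T\<^sub>i Y\<^sub>w = Y\<^bsub>w s\<^sub>i\<^esub>\<close> when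
  \<open>w s\<^sub>i < w\<close>, and the quadratic relation \<open>T\<^sub>i Tbar\<^sub>i = p q\<close> then determines \<open>Tbar\<^sub>i Y\<^sub>w\<close> in all
  cases. Two consequences prove the theorem. First, removing letters of a reduced word from the right
  shows \<open>ev (Tbar\<^sub>u Y\<^sub>w) = \<delta>\<^bsub>u,w\<^esub> ev (Y\<^sub>i\<^sub>d)\<close>, because the unwanted terms would require \<open>i\<close> to be both an
  ascent and a descent of the same permutation. Second, \<open>Tbar\<^sub>i Y\<^sub>\<lambda> = p Y\<^sub>\<lambda>\<close> for \<open>i \<noteq> k\<close>, so the
  symmetrizer \<open>\<Sigma>\<close> acts on \<open>Y\<^sub>\<lambda>\<close> by the normalised Poincare polynomial of \<open>S\<^sub>k \<times> S\<^bsub>n-k\<^esub>\<close>,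
  that is, by 1. What remains is \<open>w\<^sub>\<mu> = w\<^sub>\<nu> v\<close> with \<open>v \<in> S\<^sub>k \<times> S\<^bsub>n-k\<^esub>\<close>, which forces
  \<open>\<mu> = \<nu>\<close> and \<open>v = id\<close>.
\<close>

subsection \<open>Inversions and reduced words\<close>

lemma sref_apply_involution [simp]: "sref i (sref i a) = a"
  by (simp add: sref_def)

lemma comp_sref_sref [simp]: "w \<circ> sref i \<circ> sref i = w" "sref i \<circ> (sref i \<circ> w) = w"
  by (simp_all add: fun_eq_iff)

lemma sref_simps [simp]: "sref i i = Suc i" "sref i (Suc i) = i" "a \<noteq> i \<Longrightarrow> a \<noteq> Suc i \<Longrightarrow> sref i a = a"
  by (auto simp: sref_def transpose_def)

lemma sref_permutes: "i \<in> {1..<n} \<Longrightarrow> sref i permutes {1..n}"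
  unfolding sref_def by (rule permutes_swap_id) auto

text \<open>No integer lies strictly between \<open>i\<close> and \<open>Suc i\<close>, so swapping
  them can reverse the order of that single pair only.\<close>

lemma sref_less: "a < b \<Longrightarrow> (a, b) \<noteq> (i, Suc i) \<Longrightarrow> sref i a < sref i b"
  unfolding sref_def transpose_def by auto

lemma inv_sref_comp: "w permutes S \<Longrightarrow> inv (sref i \<circ> w) = inv w \<circ> sref i"
  using o_inv_distrib[of "sref i" w] permutes_bij[of w S] 
  by (simp add: sref_def)

lemma inv_comp_sref: "w permutes S \<Longrightarrow> inv (w \<circ> sref i) = sref i \<circ> inv w"
  using o_inv_distrib[of w "sref i"] permutes_bij[of w S] 
  by (simp add: sref_def)

lemma sref_comp_permutes: "i \<in> {1..<n} \<Longrightarrow> w permutes {1..n} \<Longrightarrow> sref i \<circ> w permutes {1..n}"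
  by (intro permutes_compose sref_permutes)

lemma comp_sref_permutes: "i \<in> {1..<n} \<Longrightarrow> w permutes {1..n} \<Longrightarrow> w \<circ> sref i permutes {1..n}"
  by (intro permutes_compose sref_permutes)

text \<open>Relabelling positions by \<open>sref i\<close> carries the inversions of
  \<open>w\<close> injectively to inversions of \<open>w \<circ> sref i\<close>; the only further
  inversion is \<open>(i, Suc i)\<close> itself.\<close>

lemma inv_count_comp_sref_ascent:
  assumes "i \<in> {1..<n}" and "w i < w (Suc i)"
  shows "inv_count n (w \<circ> sref i) = Suc (inv_count n w)"
proof -
  define I where "I u = {(a, b). 1 \<le> a \<and> a < b \<and> b \<le> n \<and> u b < u a}" for u :: "nat \<Rightarrow> nat"
  have fin: "finite (I w)"
    by (rule finite_subset[of _ "{1..n} \<times> {1..n}"]) (auto simp: I_def)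
  have s: "sref i a \<in> {1..n}" if "a \<in> {1..n}" for a
    using permutes_in_image[OF sref_permutes[OF assms(1)]] that by blast
  have 1: "(a, b) \<in> insert (i, Suc i) (map_prod (sref i) (sref i) ` I w)"
    if "(a, b) \<in> I (w \<circ> sref i)" for a b
  proof (cases "(a, b) = (i, Suc i)")
    case False
    then have "(sref i a, sref i b) \<in> I w"
      using that sref_less[of a b i] s[of a] s[of b] by (auto simp: I_def)
    then have "map_prod (sref i) (sref i) (sref i a, sref i b) \<in> map_prod (sref i) (sref i) ` I w"
      by (rule imageI)
    then show ?thesis by simp
  qed simp
  have 2: "(sref i a, sref i b) \<in> I (w \<circ> sref i)" if "(a, b) \<in> I w" for a b
  proof -
    have "(a, b) \<noteq> (i, Suc i)" using that assms by (auto simp: I_def)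
    then show ?thesis using that sref_less[of a b i] s[of a] s[of b] by (auto simp: I_def)
  qed
  have 3: "(i, Suc i) \<in> I (w \<circ> sref i)" using assms by (auto simp: I_def)
  have "I (w \<circ> sref i) = insert (i, Suc i) (map_prod (sref i) (sref i) ` I w)"
    using 1 2 3 by auto
  \<comment> \<open>Its preimage would be \<open>(Suc i, i)\<close>, which is not an increasing pair
    of positions.\<close>
  moreover have "(i, Suc i) \<notin> map_prod (sref i) (sref i) ` I w"
  proof
    assume "(i, Suc i) \<in> map_prod (sref i) (sref i) ` I w"
    then obtain a b where "(a, b) \<in> I w" "sref i a = i" "sref i b = Suc i" by auto
    moreover from this have "a = Suc i" "b = i"
      by (metis sref_apply_involution sref_simps(1,2))+
    ultimately show False by (simp add: I_def)
  qed
  moreover have "inj (map_prod (sref i) (sref i))"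
    by (intro prod.inj_map) (metis injI sref_apply_involution)+
  ultimately have "card (I (w \<circ> sref i)) = Suc (card (I w))"
    using fin by (simp add: card_image inj_on_subset[OF _ subset_UNIV])
  then show ?thesis by (simp add: inv_count_def I_def)
qed

text \<open>Inversion exchanges positions and values. This transfers facts about right
  multiplication by \<open>sref i\<close> to left multiplication, where descents are read off
  \<open>inv w\<close>.\<close>

lemma inv_count_inv:
  assumes "w permutes {1..n}"
  shows "inv_count n (inv w) = inv_count n w"
proof -
  have in_range: "1 \<le> u a \<and> u a \<le> n \<longleftrightarrow> 1 \<le> a \<and> a \<le> n" if "u permutes {1..n}" for u a
    using permutes_in_image[OF that, of a] by simp
  note r = in_range[OF assms] in_range[OF permutes_inv[OF assms]]
  have "bij_betw (\<lambda>(a, b). (w b, w a)) {(a, b). 1 \<le> a \<and> a < b \<and> b \<le> n \<and> w b < w a}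
     {(a, b). 1 \<le> a \<and> a < b \<and> b \<le> n \<and> inv w b < inv w a}"
    using r
    by (intro bij_betw_byWitness[where f' = "\<lambda>(a, b). (inv w b, inv w a)"])
      (force simp: permutes_inverses[OF assms])+
  then show ?thesis unfolding inv_count_def by (rule bij_betw_same_card[symmetric])
qed

lemma inv_count_sref_comp_ascent:
  assumes "i \<in> {1..<n}" and "w permutes {1..n}" and "inv w i < inv w (Suc i)"
  shows "inv_count n (sref i \<circ> w) = Suc (inv_count n w)"
proof -
  have "inv_count n (sref i \<circ> w) = inv_count n (inv (sref i \<circ> w))"
    using assms by (simp only: inv_count_inv[OF sref_comp_permutes])
  also have "\<dots> = Suc (inv_count n (inv w))"
    using assms by (simp only: inv_sref_comp inv_count_comp_sref_ascent)
  finally show ?thesis using assms by (simp add: inv_count_inv)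
qed

lemma permutes_Suc_neq: "w permutes S \<Longrightarrow> w (Suc i) \<noteq> w i"
  by (metis n_not_Suc_n permutes_inj injD)

lemma inv_count_comp_sref_descent:
  assumes "i \<in> {1..<n}" and "w (Suc i) < w i"
  shows "Suc (inv_count n (w \<circ> sref i)) = inv_count n w"
  using inv_count_comp_sref_ascent[OF assms(1), of "w \<circ> sref i"] assms(2) by simp

lemma inv_count_sref_comp_descent:
  assumes "i \<in> {1..<n}" and "w permutes {1..n}" and "inv w (Suc i) < inv w i"
  shows "Suc (inv_count n (sref i \<circ> w)) = inv_count n w"
  using inv_count_sref_comp_ascent[OF assms(1) sref_comp_permutes[OF assms(1,2)]] assms(3)
  by (simp add: inv_sref_comp[OF assms(2)])

section \<open>Words, reduced words and descents\<close>

lemma word_perm_simps [simp]: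
  "word_perm [] = id" "word_perm (i # ws) = sref i \<circ> word_perm ws"
  by (simp_all add: word_perm_def)

lemma word_perm_append: "word_perm (vs @ ws) = word_perm vs \<circ> word_perm ws"
  by (induction vs) (simp_all add: comp_assoc)

lemma word_perm_permutes: "set ws \<subseteq> {1..<n} \<Longrightarrow> word_perm ws permutes {1..n}"
proof (induction ws)
  case (Cons i ws)
  then have "sref i \<circ> word_perm ws permutes {1..n}" by (intro sref_comp_permutes) auto
  then show ?case by (simp only: word_perm_simps)
qed (simp add: permutes_id)

lemma reduced_word_permutes: "reduced_word n w ws \<Longrightarrow> w permutes {1..n}"
  using word_perm_permutes by (auto simp: reduced_word_def)

lemma inv_count_id [simp]: "inv_count n id = 0"
  by (auto simp: inv_count_def card_eq_0_iff)

text \<open>Each letter changes the number of inversions by exactly one. The bound is what forces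
  the outer letters of a reduced word to be descents.\<close>

lemma inv_count_word_perm_le: "set ws \<subseteq> {1..<n} \<Longrightarrow> inv_count n (word_perm ws) \<le> length ws"
proof (induction ws)
  case (Cons i ws)
  let ?w = "word_perm ws"
  have i: "i \<in> {1..<n}" and w: "?w permutes {1..n}"
    using Cons.prems word_perm_permutes by auto
  have "inv_count n (sref i \<circ> ?w) \<le> Suc (inv_count n ?w)"
    using inv_count_sref_comp_ascent[OF i w] inv_count_sref_comp_descent[OF i w]
      permutes_Suc_neq[OF permutes_inv[OF w], of i] by linarith
  then show ?case using Cons by (simp del: o_apply)
qed simp

lemma reduced_word_Cons_ascent:
  assumes "reduced_word n w ws" and "i \<in> {1..<n}" and "inv w i < inv w (Suc i)"
  shows "reduced_word n (sref i \<circ> w) (i # ws)"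
  using assms inv_count_sref_comp_ascent[OF assms(2) reduced_word_permutes[OF assms(1)] assms(3)]
  unfolding reduced_word_def by simp

lemma reduced_word_Cons_descent:
  assumes "w permutes {1..n}" and "reduced_word n (sref i \<circ> w) ws"
    and "i \<in> {1..<n}" and "inv w (Suc i) < inv w i"
  shows "reduced_word n w (i # ws)"
  using reduced_word_Cons_ascent[OF assms(2,3)] assms(4) by (simp add: inv_sref_comp[OF assms(1)])

text \<open>If \<open>i\<close> were a left ascent of \<open>w\<close>, the permutation of the
  remaining word \<open>ws\<close> would have more inversions than \<open>ws\<close> has
  letters.\<close>

lemma reduced_word_ConsD:
  assumes "reduced_word n w (i # ws)"
  shows "i \<in> {1..<n}" "inv w (Suc i) < inv w i" "reduced_word n (sref i \<circ> w) ws"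
proof -
  let ?u = "word_perm ws"
  have i: "i \<in> {1..<n}" and ws: "set ws \<subseteq> {1..<n}" and w: "w = sref i \<circ> ?u"
    and l: "inv_count n w = Suc (length ws)"
    using assms by (auto simp: reduced_word_def)
  note wp = reduced_word_permutes[OF assms]
  have u: "sref i \<circ> w = ?u" by (simp add: w)
  show "i \<in> {1..<n}" by (rule i)
  show d: "inv w (Suc i) < inv w i"
  proof (rule ccontr)
    assume "\<not> inv w (Suc i) < inv w i"
    then have "inv w i < inv w (Suc i)"
      using permutes_Suc_neq[OF permutes_inv[OF wp], of i] by simp
    from inv_count_sref_comp_ascent[OF i wp this] show False
      using inv_count_word_perm_le[OF ws] l u by simp
  qed
  show "reduced_word n (sref i \<circ> w) ws"
    using inv_count_sref_comp_descent[OF i wp d] l ws u by (simp add: reduced_word_def)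
qed

text \<open>Mirror image of \<open>reduced_word_ConsD\<close>. It is needed because the rightmost
  generator of a word operator acts first on a basis vector, and it does so through right
  multiplication of the index.\<close>

lemma reduced_word_snocD:
  assumes "reduced_word n w (ws @ [i])"
  shows "i \<in> {1..<n}" "w (Suc i) < w i" "reduced_word n (w \<circ> sref i) ws"
proof -
  let ?u = "word_perm ws"
  have "word_perm (ws @ [i]) = w" using assms by (simp only: reduced_word_def)
  then have w: "w = ?u \<circ> sref i" unfolding word_perm_append by simp
  have i: "i \<in> {1..<n}" and ws: "set ws \<subseteq> {1..<n}" and l: "inv_count n w = Suc (length ws)"
    using assms by (simp_all add: reduced_word_def del: One_nat_def)
  note wp = reduced_word_permutes[OF assms]
  have u: "w \<circ> sref i = ?u" by (simp add: w)
  show "i \<in> {1..<n}" by (rule i)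
  show d: "w (Suc i) < w i"
  proof (rule ccontr)
    assume "\<not> w (Suc i) < w i"
    then have "w i < w (Suc i)"
      using permutes_Suc_neq[OF wp, of i] by simp
    from inv_count_comp_sref_ascent[of i n w, OF i this] show False
      using inv_count_word_perm_le[OF ws] l u by simp
  qed
  show "reduced_word n (w \<circ> sref i) ws"
    using inv_count_comp_sref_descent[of i n w, OF i d] l ws u by (simp add: reduced_word_def)
qed

lemma strict_mono_on_sorted_wrt:
  fixes f :: "nat \<Rightarrow> nat"
  assumes "strict_mono_on {a..<b} f"
  shows "sorted_wrt (<) (map f [a..<b])"
  unfolding sorted_wrt_map
  by (rule sorted_wrt_mono_rel[OF _ sorted_wrt_upt]) (auto intro: strict_mono_onD[OF assms])

text \<open>Both value lists are strictly sorted with the same set of entries. The half-open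
  interval matches \<open>[a..<b]\<close>.\<close>

lemma strict_mono_on_image_unique:
  fixes f g :: "nat \<Rightarrow> nat"
  assumes "strict_mono_on {a..<b} f" and "strict_mono_on {a..<b} g" and "f ` {a..<b} = g ` {a..<b}"
    and "j \<in> {a..<b}"
  shows "f j = g j"
proof -
  have "map f [a..<b] = map g [a..<b]"
    using strict_mono_on_sorted_wrt[OF assms(1)] strict_mono_on_sorted_wrt[OF assms(2)] assms(3)
    unfolding strict_sorted_iff
    by (intro sorted_distinct_set_unique) (simp_all only: set_map set_upt)
  then show ?thesis using assms(4) by simp
qed

lemma strict_mono_on_stepI:
  fixes f :: "nat \<Rightarrow> nat"
  assumes "\<And>i. a \<le> i \<Longrightarrow> Suc i \<le> b \<Longrightarrow> f i < f (Suc i)"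
  shows "strict_mono_on {a..b} f"
proof (rule strict_mono_onI)
  fix r s assume "r \<in> {a..b}" "s \<in> {a..b}" "r < s"
  then show "f r < f s"
  proof (induction s)
    case (Suc s)
    then show ?case using assms[of s] by (cases "r = s") auto
  qed simp
qed

lemma permutes_strict_mono_on_id:
  fixes w :: "nat \<Rightarrow> nat"
  assumes "w permutes {1..n}" and "strict_mono_on {1..n} w"
  shows "w = id"
proof
  fix j
  have "w j = id j" if "j \<in> {1..n}"
    using that assms permutes_image[OF assms(1)]
    by (intro strict_mono_on_image_unique[of 1 "Suc n" w id])
      (auto simp: atLeastLessThanSuc_atLeastAtMost strict_mono_on_def)
  then show "w j = id j" using permutes_not_in[OF assms(1), of j] by auto
qed

lemma reduced_word_exists:
  assumes "w permutes {1..n}"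
  shows "\<exists>ws. reduced_word n w ws"
  using assms
proof (induction "inv_count n w" arbitrary: w rule: less_induct)
  case less
  note inv_w = permutes_inv[OF less.prems]
  show ?case
  proof (cases "\<exists>i\<in>{1..<n}. inv w (Suc i) < inv w i")
    case True
    then obtain i where i: "i \<in> {1..<n}" "inv w (Suc i) < inv w i" by blast
    have "inv_count n (sref i \<circ> w) < inv_count n w"
      using inv_count_sref_comp_descent[OF i(1) less.prems i(2)] by simp
    from less.hyps[OF this sref_comp_permutes[OF i(1) less.prems]]
    show ?thesis using reduced_word_Cons_descent[OF less.prems _ i] by blast
  next
    \<comment> \<open>Without a left descent, \<open>inv w\<close> is increasing on
      \<open>{1..n}\<close>, hence the identity, and the empty word works.\<close>
    case False
    then have "strict_mono_on {1..n} (inv w)"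
      using permutes_Suc_neq[OF inv_w]
      by (intro strict_mono_on_stepI) (meson Suc_le_eq atLeastLessThan_iff linorder_neqE_nat)
    then have "inv w = id" by (rule permutes_strict_mono_on_id[OF inv_w])
    then have "w = id" by (metis inv_id inv_inv_eq less.prems permutes_bij)
    then show ?thesis by (intro exI[of _ "[]"]) (simp add: reduced_word_def)
  qed
qed

section \<open>Independence of the reduced word\<close>

lemma word_op_simps [simp]: "word_op T [] = id" "word_op T (i # ws) = T i \<circ> word_op T ws"
  by (simp_all add: word_op_def)

lemma word_op_snoc: "word_op T (ws @ [i]) = word_op T ws \<circ> T i"
  by (induction ws) (simp_all add: comp_assoc)

text \<open>Matsumoto's theorem for the symmetric group. If two reduced words begin with different
  letters \<open>i\<close> and \<open>j\<close>, then both are left descents, so \<open>w\<close> also has reduced words beginning with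
  the two sides of the braid relation between \<open>i\<close> and \<open>j\<close>.\<close>

lemma word_op_reduced_unique:
  assumes comm: "\<And>i j. i \<in> {1..<n} \<Longrightarrow> j \<in> {1..<n} \<Longrightarrow> Suc i < j \<Longrightarrow> T i \<circ> T j = T j \<circ> T i"
    and braid: "\<And>i. 1 \<le> i \<Longrightarrow> Suc i < n \<Longrightarrow> T i \<circ> (T (Suc i) \<circ> T i) = T (Suc i) \<circ> (T i \<circ> T (Suc i))"
    and "reduced_word n w vs" and "reduced_word n w ws"
  shows "word_op T vs = word_op T ws"
  using assms(3,4)
proof (induction "length vs" arbitrary: w vs ws rule: less_induct)
  case less
  have len: "length ws = length vs" using less.prems by (simp add: reduced_word_def)
  have w: "w permutes {1..n}" by (rule reduced_word_permutes[OF less.prems(1)])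
  have IH: "word_op T a = word_op T b"
    if "length a < length vs" "reduced_word n u a" "reduced_word n u b" for u a b
    by (rule less.hyps[OF that])
  have key: "T i \<circ> word_op T a = T j \<circ> word_op T b"
    if ij: "i < j" and ra: "reduced_word n w (i # a)" and rb: "reduced_word n w (j # b)"
      and la: "length a < length vs" and lb: "length b < length vs" for i j a b
  proof -
    note A = reduced_word_ConsD[OF ra] and B = reduced_word_ConsD[OF rb]
    have si: "sref i \<circ> w permutes {1..n}" and sj: "sref j \<circ> w permutes {1..n}"
      by (rule sref_comp_permutes[OF A(1) w] sref_comp_permutes[OF B(1) w])+
    show ?thesis
    proof (cases "j = Suc i")
      case False
      \<comment> \<open>For distant letters, a reduced word \<open>c\<close> of this common element
        extends to \<open>j # c\<close> and \<open>i # c\<close>, which the induction hypothesis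
        compares with \<open>a\<close> and \<open>b\<close>.\<close>
      have eq: "sref j \<circ> (sref i \<circ> w) = sref i \<circ> (sref j \<circ> w)"
        using ij False by (auto simp: fun_eq_iff sref_def transpose_def)
      have "sref j \<circ> (sref i \<circ> w) permutes {1..n}"
        by (rule sref_comp_permutes[OF B(1) si])
      then obtain c where c: "reduced_word n (sref j \<circ> (sref i \<circ> w)) c"
        using reduced_word_exists by blast
      have "reduced_word n (sref i \<circ> w) (j # c)"
        using ij False A B by (intro reduced_word_Cons_descent[OF si c]) (auto simp: inv_sref_comp[OF w])
      moreover have "reduced_word n (sref j \<circ> w) (i # c)"
        using ij False A B c unfolding eq
        by (intro reduced_word_Cons_descent[OF sj]) (auto simp: inv_sref_comp[OF w])
      ultimately have "word_op T a = T j \<circ> word_op T c" "word_op T b = T i \<circ> word_op T c"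
        using IH[OF la A(3)] IH[OF lb B(3)] by auto
      then show ?thesis
        using comm[OF A(1) B(1)] ij False by (simp flip: comp_assoc)
    next
      case True
      \<comment> \<open>For adjacent letters three reflections are stripped off. A reduced word
        \<open>c\<close> of the result extends to \<open>j # i # c\<close> and
        \<open>i # j # c\<close>, so prefixing the remaining letter produces the two sides of the
        braid relation.\<close>
      have eq: "sref i \<circ> (sref j \<circ> (sref i \<circ> w)) = sref j \<circ> (sref i \<circ> (sref j \<circ> w))"
        using True by (auto simp: fun_eq_iff sref_def transpose_def)
      have sji: "sref j \<circ> (sref i \<circ> w) permutes {1..n}" and sij: "sref i \<circ> (sref j \<circ> w) permutes {1..n}"
        by (rule sref_comp_permutes[OF B(1) si] sref_comp_permutes[OF A(1) sj])+
      have "sref i \<circ> (sref j \<circ> (sref i \<circ> w)) permutes {1..n}"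
        by (rule sref_comp_permutes[OF A(1) sji])
      then obtain c where c: "reduced_word n (sref i \<circ> (sref j \<circ> (sref i \<circ> w))) c"
        using reduced_word_exists by blast
      have "reduced_word n (sref j \<circ> (sref i \<circ> w)) (i # c)"
        using True A B
        by (intro reduced_word_Cons_descent[OF sji c])
          (auto simp: inv_sref_comp[OF w] inv_sref_comp[OF si])
      then have "reduced_word n (sref i \<circ> w) (j # i # c)"
        using True A B by (intro reduced_word_Cons_descent[OF si]) (auto simp: inv_sref_comp[OF w])
      moreover have "reduced_word n (sref i \<circ> (sref j \<circ> w)) (j # c)"
        using True A B c unfolding eq
        by (intro reduced_word_Cons_descent[OF sij])
          (auto simp: inv_sref_comp[OF w] inv_sref_comp[OF sj[unfolded True]])
      then have "reduced_word n (sref j \<circ> w) (i # j # c)"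
        using True A B by (intro reduced_word_Cons_descent[OF sj]) (auto simp: inv_sref_comp[OF w])
      ultimately have "word_op T a = T j \<circ> (T i \<circ> word_op T c)" "word_op T b = T i \<circ> (T j \<circ> word_op T c)"
        using IH[OF la A(3)] IH[OF lb B(3)] by auto
      then show ?thesis
        using braid[of i] True A(1) B(1) by (auto simp: fun_eq_iff)
    qed
  qed
  show ?case
  proof (cases vs)
    case Nil
    then show ?thesis using len by simp
  next
    case (Cons i a)
    with len obtain j b where ws: "ws = j # b" by (cases ws) auto
    have ra: "reduced_word n w (i # a)" and rb: "reduced_word n w (j # b)"
      using less.prems Cons ws by simp_all
    have l: "length a < length vs" "length b < length vs" using Cons ws len by simp_all
    consider "i < j" | "j < i" | "i = j" by linarith
    then show ?thesis
    proof cases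
      case 1
      then show ?thesis using key[OF 1 ra rb l] Cons ws by simp
    next
      case 2
      then show ?thesis using key[OF 2 rb ra l(2,1)] Cons ws by simp
    next
      case 3
      then show ?thesis
        using IH[OF l(1) reduced_word_ConsD(3)[OF ra] reduced_word_ConsD(3)[OF rb[folded 3]]] Cons ws
        by simp
    qed
  qed
qed

subsection \<open>The parabolic subgroup and its Poincare polynomial\<close>

lemma finite_parabolic [simp]: "finite (parabolic n k)"
  by (rule finite_subset[of _ "{v. v permutes {1..n}}"]) (auto simp: parabolic_def finite_permutations)

lemma id_in_parabolic [simp]: "id \<in> parabolic n k"
  by (simp add: parabolic_def permutes_id)

lemma parabolic_permutes: "u \<in> parabolic n k \<Longrightarrow> u permutes {1..n}"
  by (simp add: parabolic_def)

lemma parabolic_le_iff: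
  assumes "u \<in> parabolic n k" and "1 \<le> a"
  shows "u a \<le> k \<longleftrightarrow> a \<le> k"
proof -
  have u: "u permutes {1..n}" and im: "u ` {1..k} = {1..k}" using assms by (auto simp: parabolic_def)
  have pos: "1 \<le> u a"
    using permutes_in_image[OF u, of 0] permutes_not_in[OF u, of 0] permutes_inj[OF u] assms(2)
    by (metis One_nat_def Suc_leI atLeastAtMost_iff injD le_zero_eq neq0_conv not_one_le_zero)
  have "u a \<in> u ` {1..k} \<longleftrightarrow> a \<in> {1..k}"
    by (rule inj_image_mem_iff[OF permutes_inj[OF u]])
  then show ?thesis using assms(2) pos unfolding im by simp
qed

lemma sref_in_parabolic:
  assumes "i \<in> {1..<n}" and "i \<noteq> k"
  shows "sref i \<in> parabolic n k"
proof -
  have sub: "sref i ` {1..k} \<subseteq> {1..k}"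
    using assms by (auto simp: sref_def transpose_def)
  have "inj_on (sref i) {1..k}" by (rule inj_on_inverseI[of _ "sref i"]) simp
  then have "sref i ` {1..k} = {1..k}" by (intro endo_inj_surj sub) simp_all
  then show ?thesis using sref_permutes[OF assms(1)] by (simp add: parabolic_def)
qed

lemma parabolic_comp: "u \<in> parabolic n k \<Longrightarrow> v \<in> parabolic n k \<Longrightarrow> u \<circ> v \<in> parabolic n k"
  by (auto simp: parabolic_def permutes_compose simp flip: image_image)

lemma parabolic_inv:
  assumes "u \<in> parabolic n k"
  shows "inv u \<in> parabolic n k"
proof -
  have u: "u permutes {1..n}" and im: "u ` {1..k} = {1..k}" using assms by (auto simp: parabolic_def)
  have "inv u ` {1..k} = {1..k}"
    using image_inv_f_f[OF permutes_inj[OF u], of "{1..k}"] unfolding im .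
  then show ?thesis using permutes_inv[OF u] by (simp add: parabolic_def)
qed

text \<open>\<open>inv u\<close> preserves \<open>{1..k}\<close>, so
  \<open>inv u k \<le> k < inv u (Suc k)\<close> and \<open>k\<close> is never a left descent;
  stripping any other letter stays in the subgroup.\<close>

lemma parabolic_reduced_word_notin:
  assumes "reduced_word n u ws" and "u \<in> parabolic n k"
  shows "k \<notin> set ws"
  using assms
proof (induction ws arbitrary: u)
  case (Cons i ws)
  note D = reduced_word_ConsD[OF Cons.prems(1)]
  have "i \<noteq> k"
    using D(1,2) parabolic_le_iff[OF parabolic_inv[OF Cons.prems(2)], of i]
      parabolic_le_iff[OF parabolic_inv[OF Cons.prems(2)], of "Suc i"] by auto
  moreover have "k \<notin> set ws"
    using Cons.IH[OF D(3)] parabolic_comp[OF sref_in_parabolic[OF D(1) \<open>i \<noteq> k\<close>] Cons.prems(2)] by blast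
  ultimately show ?case by simp
qed simp

section \<open>Inserting the value \<open>n + 1\<close>: the recursion for the Poincare
  polynomial\<close>

lemma inv_count_Suc:
  assumes "u permutes {1..n}"
  shows "inv_count (Suc n) u = inv_count n u"
proof -
  have "u (Suc n) = Suc n" using permutes_not_in[OF assms] by simp
  moreover have "u i \<le> n" if "1 \<le> i" "i \<le> n" for i
    using permutes_in_image[OF assms, of i] that by simp
  ultimately have "{(i, j). 1 \<le> i \<and> i < j \<and> j \<le> Suc n \<and> u j < u i} =
    {(i, j). 1 \<le> i \<and> i < j \<and> j \<le> n \<and> u j < u i}"
    by (force simp: le_Suc_eq)
  then show ?thesis by (simp only: inv_count_def)
qed

text \<open>Composing \<open>u\<close> with \<open>tail_cycle n m\<close> inserts the value \<open>n + 1\<close> at position \<open>n + 1 - m\<close> of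
  the one-line notation of \<open>u\<close>, which creates exactly \<open>m\<close> new inversions.\<close>

fun tail_cycle :: "nat \<Rightarrow> nat \<Rightarrow> nat \<Rightarrow> nat" where
  "tail_cycle n 0 = id"
| "tail_cycle n (Suc m) = tail_cycle n m \<circ> sref (n - m)"

lemma tail_cycle_apply:
  "m \<le> n \<Longrightarrow> tail_cycle n m (Suc n - m) = Suc n"
  "m \<le> n \<Longrightarrow> a < Suc n - m \<Longrightarrow> tail_cycle n m a = a"
proof (induction m arbitrary: a)
  case (Suc m)
  { case 1
    then show ?case using Suc.IH(1) by (simp add: Suc_diff_le)
  next
    case 2
    then show ?case using Suc.IH(2) by simp }
qed simp_all

lemma tail_cycle_parabolic: "m \<le> n - k \<Longrightarrow> tail_cycle n m \<in> parabolic (Suc n) k"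
proof (induction m)
  case (Suc m)
  then have "sref (n - m) \<in> parabolic (Suc n) k" by (intro sref_in_parabolic) auto
  moreover have "tail_cycle n m \<in> parabolic (Suc n) k" using Suc by simp
  ultimately show ?case unfolding tail_cycle.simps by (intro parabolic_comp)
qed simp

lemma inv_count_comp_tail_cycle:
  assumes "u permutes {1..n}" and "m \<le> n"
  shows "inv_count (Suc n) (u \<circ> tail_cycle n m) = inv_count n u + m"
  using assms(2)
proof (induction m)
  case (Suc m)
  let ?w = "u \<circ> tail_cycle n m"
  have "u (Suc n) = Suc n" using permutes_not_in[OF assms(1)] by simp
  then have 1: "?w (Suc (n - m)) = Suc n"
    using tail_cycle_apply(1)[of m n] Suc.prems by (simp add: Suc_diff_le)
  have "?w (n - m) = u (n - m)"
    using tail_cycle_apply(2)[of m n "n - m"] Suc.prems by simp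
  also have "n - m \<in> {1..n}" using Suc.prems by auto
  then have "u (n - m) \<le> n" using permutes_in_image[OF assms(1)] by fastforce
  finally have "?w (n - m) < ?w (Suc (n - m))" using 1 by simp
  then have "inv_count (Suc n) (?w \<circ> sref (n - m)) = Suc (inv_count (Suc n) ?w)"
    using Suc.prems by (intro inv_count_comp_sref_ascent) auto
  also have "inv_count (Suc n) ?w = inv_count n u + m" by (rule Suc.IH) (use Suc.prems in simp)
  finally show ?case unfolding tail_cycle.simps comp_assoc by simp
qed (simp add: inv_count_Suc[OF assms(1)])

text \<open>The position of the value \<open>Suc n\<close> determines \<open>m\<close>, and undoing
  the cycle then recovers \<open>u\<close>. The bound \<open>m \<le> n - k\<close> says that this
  position lies in the second block.\<close>

lemma parabolic_Suc_bij:
  assumes "k \<le> n"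
  shows "bij_betw (\<lambda>(u, m). u \<circ> tail_cycle n m) (parabolic n k \<times> {..n - k}) (parabolic (Suc n) k)"
proof (intro bij_betw_imageI)
  have cyc: "bij (tail_cycle n m)" if "m \<le> n - k" for m
    using tail_cycle_parabolic[OF that] parabolic_permutes permutes_bij by blast
  have last: "u (Suc n) = Suc n" if "u \<in> parabolic n k" for u
    using permutes_not_in[OF parabolic_permutes[OF that]] by simp
  have lift: "u \<in> parabolic (Suc n) k" if "u \<in> parabolic n k" for u
    using that permutes_subset[of u "{1..n}" "{1..Suc n}"] by (auto simp: parabolic_def)
  show "inj_on (\<lambda>(u, m). u \<circ> tail_cycle n m) (parabolic n k \<times> {..n - k})"
  proof (rule inj_onI, clarify)
    fix u m v l
    assume u: "u \<in> parabolic n k" and v: "v \<in> parabolic n k" and m: "m \<le> n - k" and l: "l \<le> n - k"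
      and eq: "u \<circ> tail_cycle n m = v \<circ> tail_cycle n l"
    \<comment> \<open>Both positions carry the value \<open>Suc n\<close>, so injectivity identifies
      them.\<close>
    have "(u \<circ> tail_cycle n m) (Suc n - m) = (u \<circ> tail_cycle n m) (Suc n - l)"
      unfolding eq[THEN fun_cong, of "Suc n - l"] 
      using tail_cycle_apply(1)[of m n] tail_cycle_apply(1)[of l n] m l last[OF u] last[OF v] by simp
    moreover have "inj (u \<circ> tail_cycle n m)"
      using permutes_inj[OF parabolic_permutes[OF u]] cyc[OF m] by (intro inj_compose) (auto simp: bij_def)
    ultimately have "Suc n - m = Suc n - l" by (rule injD[rotated])
    then have ml: "m = l" using m l by simp
    have "u \<circ> tail_cycle n m \<circ> inv (tail_cycle n m) = v \<circ> tail_cycle n m \<circ> inv (tail_cycle n m)"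
      using eq ml by simp
    then show "u = v \<and> m = l" using cyc[OF m] ml by (simp add: comp_assoc surj_iff[THEN iffD1] bij_is_surj)
  qed
  show "(\<lambda>(u, m). u \<circ> tail_cycle n m) ` (parabolic n k \<times> {..n - k}) = parabolic (Suc n) k"
  proof (intro equalityI subsetI)
    fix w assume "w \<in> (\<lambda>(u, m). u \<circ> tail_cycle n m) ` (parabolic n k \<times> {..n - k})"
    then show "w \<in> parabolic (Suc n) k"
      using lift tail_cycle_parabolic parabolic_comp by auto
  next
    fix w assume w: "w \<in> parabolic (Suc n) k"
    note wp = parabolic_permutes[OF w]
    define j where "j = inv w (Suc n)"
    have wj: "w j = Suc n" unfolding j_def by (rule permutes_inverses(1)[OF wp])
    have j: "j \<in> {1..Suc n}" unfolding j_def using permutes_in_image[OF permutes_inv[OF wp]] by simp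
    have kj: "k < j" using parabolic_le_iff[OF w, of j] j wj assms by simp
    define m where "m = Suc n - j"
    have m: "m \<le> n - k" and jm: "Suc n - m = j" using kj j by (auto simp: m_def)
    define u where "u = w \<circ> inv (tail_cycle n m)"
    have uc: "u \<circ> tail_cycle n m = w" unfolding u_def
      using cyc[OF m] by (simp add: comp_assoc inj_iff[THEN iffD1] bij_is_inj)
    have "u \<in> parabolic (Suc n) k" unfolding u_def
      by (intro parabolic_comp w parabolic_inv tail_cycle_parabolic m)
    moreover have "u (Suc n) = Suc n"
      using tail_cycle_apply(1)[of m n] uc[THEN fun_cong, of j] wj jm m by simp
    moreover have "{1..Suc n} - {1..n} = {Suc n}" by auto
    ultimately have "u \<in> parabolic n k"
      using permutes_superset[of u "{1..Suc n}" "{1..n}"] by (auto simp: parabolic_def)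
    then have "(u, m) \<in> parabolic n k \<times> {..n - k}" using m by simp
    then show "w \<in> (\<lambda>(u, m). u \<circ> tail_cycle n m) ` (parabolic n k \<times> {..n - k})"
      using uc by (force simp: image_iff)
  qed
qed

text \<open>Along the insertion bijection lengths add, so the sum splits off a factor in which
  \<open>m\<close> contributes \<open>p ^ m * q ^ (n - k - m)\<close>. The length bound is
  propagated together with the sum because the exponents of \<open>q\<close> use truncated
  subtraction.\<close>

lemma parabolic_poincare_Suc:
  fixes p q :: "'f::field"
  defines "d \<equiv> \<lambda>n k. (k choose 2) + ((n - k) choose 2)"
  assumes kn: "k \<le> n" and le: "\<And>u. u \<in> parabolic n k \<Longrightarrow> inv_count n u \<le> d n k"
  shows "u \<in> parabolic (Suc n) k \<Longrightarrow> inv_count (Suc n) u \<le> d (Suc n) k"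
    and "(\<Sum>u\<in>parabolic (Suc n) k. q ^ (d (Suc n) k - inv_count (Suc n) u) * p ^ inv_count (Suc n) u) =
      (\<Sum>u\<in>parabolic n k. q ^ (d n k - inv_count n u) * p ^ inv_count n u) * qint p q (Suc n - k)"
proof -
  let ?c = "\<lambda>(u, m). u \<circ> tail_cycle n m" and ?A = "parabolic n k \<times> {..n - k}"
  have d: "d (Suc n) k = d n k + (n - k)"
    using kn by (simp add: d_def Suc_diff_le numeral_2_eq_2)
  have len: "inv_count (Suc n) (?c (u, m)) = inv_count n u + m" if "(u, m) \<in> ?A" for u m
  proof -
    have "u \<in> parabolic n k" "m \<le> n" using that by auto
    then show ?thesis using inv_count_comp_tail_cycle[OF parabolic_permutes] by simp
  qed
  note bij = parabolic_Suc_bij[OF kn]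
  show "inv_count (Suc n) u \<le> d (Suc n) k" if "u \<in> parabolic (Suc n) k"
  proof -
    have "u \<in> ?c ` ?A" using that bij_betw_imp_surj_on[OF bij] by simp
    then obtain x where x: "u = ?c x" "x \<in> ?A" by (rule imageE)
    obtain v m where "x = (v, m)" by (rule prod.exhaust)
    with x have vm: "(v, m) \<in> ?A" "u = ?c (v, m)" by simp_all
    have "inv_count (Suc n) u = inv_count n v + m" using len[OF vm(1)] vm(2) by simp
    then show ?thesis using le[of v] vm(1) d by simp
  qed
  have "(\<Sum>u\<in>parabolic (Suc n) k. q ^ (d (Suc n) k - inv_count (Suc n) u) * p ^ inv_count (Suc n) u) =
      (\<Sum>x\<in>?A. q ^ (d (Suc n) k - inv_count (Suc n) (?c x)) * p ^ inv_count (Suc n) (?c x))"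
    by (rule sum.reindex_bij_betw[OF bij, symmetric])
  also have "\<dots> = (\<Sum>(u, m)\<in>?A. (q ^ (d n k - inv_count n u) * p ^ inv_count n u) * (p ^ m * q ^ (n - k - m)))"
  proof (rule sum.cong[OF refl], clarify)
    fix u m assume u: "u \<in> parabolic n k" and m: "m \<le> n - k"
    have "d (Suc n) k - (inv_count n u + m) = (d n k - inv_count n u) + (n - k - m)"
      using le[OF u] m d by simp
    then show "q ^ (d (Suc n) k - inv_count (Suc n) (u \<circ> tail_cycle n m)) * p ^ inv_count (Suc n) (u \<circ> tail_cycle n m)
      = q ^ (d n k - inv_count n u) * p ^ inv_count n u * (p ^ m * q ^ (n - k - m))"
      using len[of u m] u m by (simp add: power_add mult_ac)
  qed
  also have "\<dots> = (\<Sum>u\<in>parabolic n k. q ^ (d n k - inv_count n u) * p ^ inv_count n u) *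
      (\<Sum>m\<le>n - k. p ^ m * q ^ (n - k - m))"
    by (simp add: sum_product sum.cartesian_product)
  also have "(\<Sum>m\<le>n - k. p ^ m * q ^ (n - k - m)) = qint p q (Suc n - k)"
    using kn by (simp add: qint_def Suc_diff_le lessThan_Suc_atMost)
  finally show "(\<Sum>u\<in>parabolic (Suc n) k. q ^ (d (Suc n) k - inv_count (Suc n) u) * p ^ inv_count (Suc n) u) =
      (\<Sum>u\<in>parabolic n k. q ^ (d n k - inv_count n u) * p ^ inv_count n u) * qint p q (Suc n - k)" .
qed

lemma qfact_Suc: "qfact p q (Suc m) = qfact p q m * qint p q (Suc m)"
  by (simp add: qfact_def)

text \<open>Each step from \<open>n\<close> to \<open>Suc n\<close> contributes
  \<open>qint p q (Suc n - k)\<close>, and these accumulate to \<open>qfact p q (n - k)\<close>. The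
  sum over \<open>parabolic k k\<close> is kept as an unevaluated factor.\<close>

lemma parabolic_poincare_aux:
  fixes p q :: "'f::field"
  assumes "\<And>u. u \<in> parabolic k k \<Longrightarrow> inv_count k u \<le> k choose 2"
    and "k \<le> n"
  shows "(\<forall>u\<in>parabolic n k. inv_count n u \<le> (k choose 2) + ((n - k) choose 2)) \<and>
    (\<Sum>u\<in>parabolic n k. q ^ ((k choose 2) + ((n - k) choose 2) - inv_count n u) * p ^ inv_count n u) =
    (\<Sum>u\<in>parabolic k k. q ^ ((k choose 2) - inv_count k u) * p ^ inv_count k u) * qfact p q (n - k)"
  using assms(2)
proof (induction n rule: dec_induct)
  case base
  then show ?case using assms(1) by (simp add: qfact_def binomial_eq_0)
next
  case (step n)
  then show ?case
    using parabolic_poincare_Suc(1)[of k n] parabolic_poincare_Suc(2)[of k n q p]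
    by (simp add: Suc_diff_le qfact_Suc mult.assoc)
qed

text \<open>Both \<open>parabolic m 0\<close> and \<open>parabolic m m\<close> are the full symmetric group, so the recursion in
  \<open>n\<close> starting from \<open>k = n\<close> is fed by the same recursion for \<open>k = 0\<close>.\<close>

lemma parabolic_poincare:
  fixes p q :: "'f::field"
  assumes "k \<le> n"
  shows "(\<Sum>u\<in>parabolic n k. q ^ ((k choose 2) + ((n - k) choose 2) - inv_count n u) * p ^ inv_count n u) =
    qfact p q k * qfact p q (n - k)"
proof -
  have full: "parabolic k k = parabolic k 0"
    using permutes_image by (auto simp: parabolic_def)
  have "parabolic 0 0 = {id}" by (auto simp: parabolic_def)
  then have 0: "(\<forall>u\<in>parabolic k 0. inv_count k u \<le> k choose 2) \<and>
    (\<Sum>u\<in>parabolic k 0. q ^ ((k choose 2) - inv_count k u) * p ^ inv_count k u) = qfact p q k"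
    using parabolic_poincare_aux[of 0 k q p] by (simp add: binomial_eq_0)
  then show ?thesis
    using parabolic_poincare_aux[OF _ assms, of q p] by (simp add: full)
qed

subsection \<open>Grassmannian permutations\<close>

lemma grass_perm_ex1:
  assumes la: "la \<in> young_box k n" and kn: "k \<le> n"
  shows "\<exists>!w. w permutes {1..n} \<and> (\<forall>j\<in>{1..k}. w j = la (k + 1 - j) + j) \<and> strict_mono_on {k+1..n} w"
proof (rule ex_ex1I)
  define f where "f j = la (k + 1 - j) + j" for j
  have f_less: "f i < f (Suc i)" if "1 \<le> i" "Suc i \<le> k" for i
  proof -
    have "la (Suc (k - i)) \<le> la (k - i)" using la that by (simp add: young_box_def)
    then show ?thesis using that by (simp add: f_def Suc_diff_le)
  qed
  then have f_mono: "strict_mono_on {1..k} f" by (intro strict_mono_on_stepI)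
  have f_inj: "inj_on f {1..k}" by (rule strict_mono_on_imp_inj_on[OF f_mono])
  have f_sub: "f ` {1..k} \<subseteq> {1..n}"
  proof clarify
    fix j assume j: "j \<in> {1..k}"
    have "la (k + 1 - j) \<le> n - k" using la by (simp add: young_box_def)
    then have "f j \<le> (n - k) + k" unfolding f_def using j by (intro add_mono) auto
    then show "f j \<in> {1..n}" using j kn by (simp add: f_def)
  qed
  define C where "C = {1..n} - f ` {1..k}"
  have C: "finite C" "card C = n - k"
    using f_sub card_image[OF f_inj] by (auto simp: C_def card_Diff_subset)
  define xs where "xs = sorted_list_of_set C"
  have xs: "sorted_wrt (<) xs" "set xs = C" "length xs = n - k" "distinct xs"
    using C by (simp_all add: xs_def)
  define w where "w j = (if j \<in> {1..k} then f j else if j \<in> {k+1..n} then xs ! (j - (k + 1)) else j)" for j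
  have "bij_betw w {k+1..n} C"
  proof -
    have "bij_betw (\<lambda>j. j - (k + 1)) {k+1..n} {..<length xs}"
      unfolding xs(3)
      by (rule bij_betw_byWitness[where f' = "\<lambda>j. j + (k + 1)"]) auto
    from bij_betw_trans[OF this bij_betw_nth[OF xs(4) refl xs(2)[symmetric]]]
    show ?thesis by (rule bij_betw_cong[THEN iffD1, rotated]) (auto simp: w_def)
  qed
  moreover have "bij_betw f {1..k} (f ` {1..k})" using f_inj by (simp add: bij_betw_def)
  then have "bij_betw w {1..k} (f ` {1..k})"
    by (rule bij_betw_cong[THEN iffD1, rotated]) (simp add: w_def)
  ultimately have "bij_betw w ({1..k} \<union> {k+1..n}) (f ` {1..k} \<union> C)"
    by (intro bij_betw_combine) (auto simp: C_def)
  moreover have "{1..k} \<union> {k+1..n} = {1..n}" "f ` {1..k} \<union> C = {1..n}"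
    using kn f_sub by (auto simp: C_def)
  ultimately have "w permutes {1..n}"
    by (intro bij_imp_permutes) (auto simp: w_def)
  moreover have "strict_mono_on {k+1..n} w"
  proof (rule strict_mono_onI)
    fix r s assume "r \<in> {k+1..n}" "s \<in> {k+1..n}" "r < s"
    then show "w r < w s" using sorted_wrt_nth_less[OF xs(1), of "r - (k + 1)" "s - (k + 1)"] xs(3)
      by (simp add: w_def)
  qed
  ultimately show "\<exists>w. w permutes {1..n} \<and> (\<forall>j\<in>{1..k}. w j = la (k + 1 - j) + j) \<and> strict_mono_on {k+1..n} w"
    by (intro exI[of _ w]) (simp add: w_def f_def)
next
  fix v w
  assume v: "v permutes {1..n} \<and> (\<forall>j\<in>{1..k}. v j = la (k + 1 - j) + j) \<and> strict_mono_on {k+1..n} v"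
    and w: "w permutes {1..n} \<and> (\<forall>j\<in>{1..k}. w j = la (k + 1 - j) + j) \<and> strict_mono_on {k+1..n} w"
  have block: "u ` {k+1..n} = {1..n} - u ` {1..k}" if "u permutes {1..n}" for u
  proof -
    have "{k+1..n} = {1..n} - {1..k}" using kn by auto
    then show ?thesis using image_set_diff[OF permutes_inj[OF that]] permutes_image[OF that] by simp
  qed
  have low: "v ` {1..k} = w ` {1..k}" using v w by (intro image_cong) auto
  then have im: "v ` {k+1..n} = w ` {k+1..n}" using block v w by simp
  show "v = w"
  proof
    fix j
    consider "j \<in> {1..k}" | "j \<in> {k+1..n}" | "j \<notin> {1..n}" by fastforce
    then show "v j = w j"
    proof cases
      case 2
      then show ?thesis using v w im strict_mono_on_image_unique[of "k+1" "Suc n" v w j]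
        by (simp add: atLeastLessThanSuc_atLeastAtMost)
    next
      case 3
      then show ?thesis using v w permutes_not_in by metis
    qed (use v w in simp)
  qed
qed

lemma
  assumes "la \<in> young_box k n" and "k \<le> n"
  shows grass_perm_permutes: "grass_perm n k la permutes {1..n}"
    and grass_perm_apply: "j \<in> {1..k} \<Longrightarrow> grass_perm n k la j = la (k + 1 - j) + j"
    and grass_perm_mono_high: "strict_mono_on {k+1..n} (grass_perm n k la)"
  using theI'[OF grass_perm_ex1[OF assms]] unfolding grass_perm_def by blast+

lemma grass_perm_mono_low:
  assumes "la \<in> young_box k n" and "k \<le> n"
  shows "strict_mono_on {1..k} (grass_perm n k la)"
proof (rule strict_mono_on_stepI)
  fix i assume i: "1 \<le> i" "Suc i \<le> k"
  have "la (Suc (k - i)) \<le> la (k - i)" using assms(1) i by (simp add: young_box_def)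
  then show "grass_perm n k la i < grass_perm n k la (Suc i)"
    using i by (simp add: grass_perm_apply[OF assms] Suc_diff_le)
qed

text \<open>For \<open>i \<noteq> k\<close> the values \<open>u i\<close> and
  \<open>u (Suc i)\<close> lie in the same block, on which the Grassmannian permutation is
  increasing.\<close>

lemma grass_perm_comp_parabolic_less_iff:
  assumes la: "la \<in> young_box k n" and kn: "k \<le> n" and u: "u \<in> parabolic n k"
    and i: "i \<in> {1..<n}" "i \<noteq> k"
  shows "grass_perm n k la (u i) < grass_perm n k la (u (Suc i)) \<longleftrightarrow> u i < u (Suc i)"
proof -
  have r: "u i \<in> {1..n}" "u (Suc i) \<in> {1..n}"
    using permutes_in_image[OF parabolic_permutes[OF u]] i by simp_all
  have "{u i, u (Suc i)} \<subseteq> {1..k} \<or> {u i, u (Suc i)} \<subseteq> {k+1..n}"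
    using parabolic_le_iff[OF u, of i] parabolic_le_iff[OF u, of "Suc i"] r i by auto
  then show ?thesis
    using strict_mono_on_less[OF grass_perm_mono_low[OF la kn]]
      strict_mono_on_less[OF grass_perm_mono_high[OF la kn]] by auto
qed

text \<open>\<open>u\<close> preserves \<open>{1..k}\<close>, so both Grassmannian permutations have
  the same image of the first block. Being increasing there they agree, and the parts of the
  partition can be read off.\<close>

lemma grass_perm_eq_comp_parabolic:
  assumes mu: "mu \<in> young_box k n" and nu: "nu \<in> young_box k n" and kn: "k \<le> n"
    and u: "u \<in> parabolic n k" and eq: "grass_perm n k mu = grass_perm n k nu \<circ> u"
  shows "mu = nu \<and> u = id"
proof -
  have im: "grass_perm n k mu ` {1..k} = grass_perm n k nu ` {1..k}"
    using u unfolding eq image_comp[symmetric] by (simp add: parabolic_def)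
  have low: "grass_perm n k mu j = grass_perm n k nu j" if "j \<in> {1..k}" for j
    using strict_mono_on_image_unique[of 1 "Suc k"] that im
      grass_perm_mono_low[OF mu kn] grass_perm_mono_low[OF nu kn]
    by (simp add: atLeastLessThanSuc_atLeastAtMost)
  have "mu i = nu i" for i
  proof (cases "i \<in> {1..k}")
    case True
    then have i: "k + 1 - i \<in> {1..k}" "k + 1 - (k + 1 - i) = i" by auto
    show ?thesis
      using low[OF i(1)] unfolding grass_perm_apply[OF mu kn i(1)] grass_perm_apply[OF nu kn i(1)] i(2)
      by simp
  next
    case False
    then have "i = 0 \<or> k < i" by auto
    then show ?thesis using mu nu by (auto simp: young_box_def)
  qed
  then have "mu = nu" by blast
  moreover have "u = id"
    using eq permutes_inj[OF grass_perm_permutes[OF nu kn]] \<open>mu = nu\<close>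
    by (metis inj_iff comp_assoc comp_id id_comp)
  ultimately show ?thesis by simp
qed

text \<open>Taking \<open>u = id\<close> in \<open>grass_perm_eq_comp_parabolic\<close> embeds the
  partitions into the permutations. Finiteness matters because a sum over an infinite set is 0 by
  convention.\<close>

lemma finite_young_box:
  assumes "k \<le> n"
  shows "finite (young_box k n)"
proof (rule inj_on_finite)
  show "inj_on (grass_perm n k) (young_box k n)"
    using grass_perm_eq_comp_parabolic[OF _ _ assms id_in_parabolic] by (auto intro: inj_onI)
  show "grass_perm n k ` young_box k n \<subseteq> {w. w permutes {1..n}}"
    using grass_perm_permutes[OF _ assms] by blast
qed (simp add: finite_permutations)

subsection \<open>Schubert representations\<close>

lemma w0_permutes: "w0 n permutes {1..n}"
  by (rule bij_imp_permutes, rule bij_betw_byWitness[where f' = "w0 n"]) (auto simp: w0_def)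

lemma inv_w0 [simp]: "inv (w0 n) = w0 n"
  by (rule inv_unique_comp) (auto simp: w0_def fun_eq_iff)

lemma perm_op_eq_word_op:
  assumes "w permutes {1..n}"
  obtains ws where "reduced_word n w ws" and "perm_op n T w = word_op T ws"
  using someI_ex[OF reduced_word_exists[OF assms]] unfolding perm_op_def by blast

text \<open>The commutation and braid relations are equations of compositions, as
  \<open>word_op_reduced_unique\<close> expects; the quadratic relation has the shape
  \<open>Tbar i (T i v) = scale (p * q) v\<close>.\<close>

locale schubert_action = vector_space scale
  for scale :: "'f::field \<Rightarrow> 'v \<Rightarrow> 'v::ab_group_add" +
  fixes n :: nat and p q :: 'f and T :: "nat \<Rightarrow> 'v \<Rightarrow> 'v"
    and Y :: "(nat \<Rightarrow> nat) \<Rightarrow> 'v" and ev :: "'v \<Rightarrow> 'f"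
  assumes T_hom: "i \<in> {1..<n} \<Longrightarrow> module_hom scale scale (T i)"
    and T_quadratic: "i \<in> {1..<n} \<Longrightarrow> T i (T i v) + scale (p - q) (T i v) = scale (p * q) v"
    and T_comm: "i \<in> {1..<n} \<Longrightarrow> j \<in> {1..<n} \<Longrightarrow> Suc i < j \<Longrightarrow> T i \<circ> T j = T j \<circ> T i"
    and T_braid: "1 \<le> i \<Longrightarrow> Suc i < n \<Longrightarrow> T i \<circ> (T (Suc i) \<circ> T i) = T (Suc i) \<circ> (T i \<circ> T (Suc i))"
    and Y_eq: "w permutes {1..n} \<Longrightarrow> Y w = perm_op n T (inv w \<circ> w0 n) (Y (w0 n))"
    and ev_hom: "module_hom scale (*) ev"
    and ev_Y: "w permutes {1..n} \<Longrightarrow> ev (Y w) \<noteq> 0 \<longleftrightarrow> w = id"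
begin

abbreviation Tbar :: "nat \<Rightarrow> 'v \<Rightarrow> 'v" where
  "Tbar \<equiv> Tbar_gen scale p q T"

lemma Tbar_hom: "i \<in> {1..<n} \<Longrightarrow> module_hom scale scale (Tbar i)"
  unfolding Tbar_gen_def
  using T_hom by (auto simp: module_hom_iff algebra_simps)

lemma word_Tbar_hom: "set ws \<subseteq> {1..<n} \<Longrightarrow> module_hom scale scale (word_op Tbar ws)"
proof (induction ws)
  case Nil
  show ?case by (simp add: module_hom_iff module_axioms)
next
  case (Cons i ws)
  then show ?case unfolding word_op_simps by (intro module_hom_compose[OF _ Tbar_hom]) auto
qed

lemma perm_Tbar_hom:
  assumes "w permutes {1..n}"
  shows "module_hom scale scale (perm_op n Tbar w)"
proof -
  obtain ws where "reduced_word n w ws" "perm_op n Tbar w = word_op Tbar ws"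
    by (rule perm_op_eq_word_op[OF assms])
  then show ?thesis using word_Tbar_hom by (simp add: reduced_word_def)
qed

lemma T_Y_descent:
  assumes w: "w permutes {1..n}" and i: "i \<in> {1..<n}" and d: "w (Suc i) < w i"
  shows "T i (Y w) = Y (w \<circ> sref i)"
proof -
  let ?u = "inv w \<circ> w0 n"
  have u: "?u permutes {1..n}" by (intro permutes_compose w0_permutes permutes_inv w)
  have inv_u: "inv ?u = w0 n \<circ> w"
    using o_inv_distrib[of "inv w" "w0 n"] permutes_bij[OF w] permutes_bij[OF w0_permutes[of n]]
    by (simp add: bij_imp_bij_inv inv_inv_eq)
  obtain ws where ws: "reduced_word n ?u ws" "perm_op n T ?u = word_op T ws"
    by (rule perm_op_eq_word_op[OF u])
  have "w i \<in> {1..n}" "w (Suc i) \<in> {1..n}" using permutes_in_image[OF w] i by simp_all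
  \<comment> \<open>\<open>w0 n\<close> reverses order on \<open>{1..n}\<close>, so the descent of
    \<open>w\<close> is an ascent here and prefixing \<open>i\<close> keeps the word
    reduced.\<close>
  then have "inv ?u i < inv ?u (Suc i)" using d unfolding inv_u by (auto simp: w0_def)
  from reduced_word_Cons_ascent[OF ws(1) i this]
  have r: "reduced_word n (inv (w \<circ> sref i) \<circ> w0 n) (i # ws)"
    unfolding inv_comp_sref[OF w] by (simp only: comp_assoc)
  obtain vs where vs: "reduced_word n (inv (w \<circ> sref i) \<circ> w0 n) vs"
    "perm_op n T (inv (w \<circ> sref i) \<circ> w0 n) = word_op T vs"
    by (rule perm_op_eq_word_op[OF reduced_word_permutes[OF r]])
  \<comment> \<open>Matsumoto's theorem makes the word chosen by \<open>SOME\<close> in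
    \<open>perm_op\<close> irrelevant.\<close>
  have "word_op T vs = word_op T (i # ws)"
    by (rule word_op_reduced_unique[where T = T, OF _ _ vs(1) r]) (rule T_comm T_braid; assumption)+
  then show ?thesis
    unfolding Y_eq[OF w] Y_eq[OF comp_sref_permutes[OF i w]] ws(2) vs(2) by simp
qed

lemma Tbar_Y_descent:
  assumes "w permutes {1..n}" and "i \<in> {1..<n}" and "w (Suc i) < w i"
  shows "Tbar i (Y w) = Y (w \<circ> sref i) + scale (p - q) (Y w)"
  by (simp only: Tbar_gen_def T_Y_descent[OF assms])

text \<open>\<open>w \<circ> sref i\<close> has a descent at \<open>i\<close>, so \<open>Y w\<close>
  is \<open>T i\<close> applied to its basis vector, and the quadratic relation evaluates
  \<open>Tbar i\<close> on it.\<close>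

lemma Tbar_Y_ascent:
  assumes w: "w permutes {1..n}" and i: "i \<in> {1..<n}" and "w i < w (Suc i)"
  shows "Tbar i (Y w) = scale (p * q) (Y (w \<circ> sref i))"
proof -
  have "T i (Y (w \<circ> sref i)) = Y (w \<circ> sref i \<circ> sref i)"
    using assms(3) by (intro T_Y_descent comp_sref_permutes w i) simp
  then have "Y w = T i (Y (w \<circ> sref i))" by simp
  then show ?thesis using T_quadratic[OF i, of "Y (w \<circ> sref i)"] by (simp only: Tbar_gen_def)
qed

lemma ev_word_Tbar_Y:
  assumes "reduced_word n u ws" and "w permutes {1..n}"
  shows "ev (word_op Tbar ws (Y w)) = (if u = w then ev (Y id) else 0)"
  using assms
proof (induction ws arbitrary: u w rule: rev_induct)
  case Nil
  then have "u = id" by (simp add: reduced_word_def)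
  then show ?case using ev_Y[OF Nil.prems(2)] by auto
next
  case (snoc i ws)
  note D = reduced_word_snocD[OF snoc.prems(1)] and w = snoc.prems(2)
  note IH = snoc.IH[OF D(3)]
  interpret h: module_hom scale "(*)" "ev \<circ> word_op Tbar ws"
    using D(3) word_Tbar_hom by (intro module_hom_compose[OF _ ev_hom]) (simp add: reduced_word_def)
  note lin = h.add[unfolded comp_apply] h.scale[unfolded comp_apply]
  note ws = comp_sref_permutes[OF D(1) w]
  have eq_iff: "u \<circ> sref i = w \<circ> sref i \<longleftrightarrow> u = w" by (metis comp_sref_sref(1))
  show ?case
  proof (cases "w i < w (Suc i)")
    case True
    \<comment> \<open>\<open>i\<close> is a descent of \<open>u\<close>, being the last letter of a
      reduced word, but an ascent of \<open>w\<close>; both sides vanish.\<close>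
    then have "u \<noteq> w" using D(2) by auto
    then show ?thesis
      unfolding word_op_snoc comp_apply Tbar_Y_ascent[OF w D(1) True] lin IH[OF ws] eq_iff by simp
  next
    case False
    then have d: "w (Suc i) < w i" using permutes_Suc_neq[OF w, of i] by simp
    \<comment> \<open>This kills the extra term \<open>scale (p - q) (Y w)\<close>: it could
      contribute only if \<open>u \<circ> sref i = w\<close>.\<close>
    have "(u \<circ> sref i) i < (u \<circ> sref i) (Suc i)" using D(2) by simp
    then have "u \<circ> sref i \<noteq> w" using d by auto
    then show ?thesis
      unfolding word_op_snoc comp_apply Tbar_Y_descent[OF w D(1) d] lin IH[OF ws] IH[OF w] eq_iff by simp
  qed
qed

lemma ev_perm_Tbar_Y:
  assumes u: "u permutes {1..n}" and w: "w permutes {1..n}"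
  shows "ev (perm_op n Tbar u (Y w)) = (if u = w then ev (Y id) else 0)"
proof -
  obtain ws where "reduced_word n u ws" "perm_op n Tbar u = word_op Tbar ws"
    by (rule perm_op_eq_word_op[OF u])
  then show ?thesis using ev_word_Tbar_Y[OF _ w] by simp
qed

section \<open>The symmetrizer and the coset sums \<open>YL\<close>\<close>

context
  fixes k :: nat
  assumes kn: "k \<le> n"
begin

abbreviation YL :: "(nat \<Rightarrow> nat) \<Rightarrow> 'v" where
  "YL \<equiv> Y_lambda scale p n k Y"

text \<open>Pairing \<open>u\<close> with \<open>u \<circ> sref i\<close> splits the sum into
  two-term pieces \<open>?a + scale p ?b\<close>, up to a scalar, and each piece is an eigenvector
  of \<open>Tbar i\<close> with eigenvalue \<open>p\<close>.\<close>

lemma Tbar_Y_lambda: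
  assumes la: "la \<in> young_box k n" and i: "i \<in> {1..<n}" "i \<noteq> k"
  shows "Tbar i (YL la) = scale p (YL la)"
proof -
  define w where "w = grass_perm n k la"
  define g where "g u = scale (p ^ inv_count n u) (Y (w \<circ> u))" for u
  \<comment> \<open>\<open>A\<close> contains exactly one element, the shorter one, of each pair
    \<open>u\<close>, \<open>u \<circ> sref i\<close>.\<close>
  define A where "A = {u \<in> parabolic n k. u i < u (Suc i)}"
  have s: "u \<circ> sref i \<in> parabolic n k" if "u \<in> parabolic n k" for u
    by (rule parabolic_comp[OF that sref_in_parabolic[OF i]])
  have fin: "finite A" by (simp add: A_def)
  have inj: "inj_on (\<lambda>u. u \<circ> sref i) A" by (rule inj_on_inverseI[of _ "\<lambda>u. u \<circ> sref i"]) simp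
  have "u \<in> A \<union> (\<lambda>u. u \<circ> sref i) ` A" if u: "u \<in> parabolic n k" for u
  proof (cases "u i < u (Suc i)")
    case False
    then have "u \<circ> sref i \<in> A"
      using s[OF u] permutes_Suc_neq[OF parabolic_permutes[OF u], of i] by (simp add: A_def)
    then show ?thesis using image_eqI[of u "\<lambda>u. u \<circ> sref i" "u \<circ> sref i" A] by simp
  qed (simp add: A_def u)
  moreover have "A \<union> (\<lambda>u. u \<circ> sref i) ` A \<subseteq> parabolic n k" using s by (auto simp: A_def)
  ultimately have split: "parabolic n k = A \<union> (\<lambda>u. u \<circ> sref i) ` A" by blast
  have disj: "A \<inter> (\<lambda>u. u \<circ> sref i) ` A = {}" by (auto simp: A_def)
  have "YL la = sum g (parabolic n k)" by (simp add: Y_lambda_def g_def w_def)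
  also have "\<dots> = (\<Sum>u\<in>A. g u) + (\<Sum>u\<in>(\<lambda>u. u \<circ> sref i) ` A. g u)"
    unfolding split by (rule sum.union_disjoint) (simp_all add: fin disj)
  also have "(\<Sum>u\<in>(\<lambda>u. u \<circ> sref i) ` A. g u) = (\<Sum>u\<in>A. g (u \<circ> sref i))"
    by (rule sum.reindex_cong[OF inj refl refl])
  finally have YL: "YL la = (\<Sum>u\<in>A. g u + g (u \<circ> sref i))" by (simp add: sum.distrib)
  interpret h: module_hom scale scale "Tbar i" by (rule Tbar_hom[OF i(1)])
  have "Tbar i (g u + g (u \<circ> sref i)) = scale p (g u + g (u \<circ> sref i))" if "u \<in> A" for u
  proof -
    have u: "u \<in> parabolic n k" and asc: "u i < u (Suc i)" using that by (auto simp: A_def)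
    let ?a = "Y (w \<circ> u)" and ?b = "Y (w \<circ> u \<circ> sref i)"
    have wu: "w \<circ> u permutes {1..n}" unfolding w_def
      by (intro permutes_compose parabolic_permutes[OF u] grass_perm_permutes[OF la kn])
    have asc': "(w \<circ> u) i < (w \<circ> u) (Suc i)"
      using grass_perm_comp_parabolic_less_iff[OF la kn u i] asc by (simp add: w_def)
    have Ta: "Tbar i ?a = scale (p * q) ?b" by (rule Tbar_Y_ascent[OF wu i(1) asc'])
    have "Tbar i ?b = Y (w \<circ> u \<circ> sref i \<circ> sref i) + scale (p - q) ?b"
      using asc' by (intro Tbar_Y_descent comp_sref_permutes[OF i(1) wu] i) simp
    then have Tb: "Tbar i ?b = ?a + scale (p - q) ?b" by (simp only: comp_sref_sref)
    have gu: "g u + g (u \<circ> sref i) = scale (p ^ inv_count n u) (?a + scale p ?b)"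
      unfolding g_def inv_count_comp_sref_ascent[of i n u, OF i(1) asc] comp_assoc[symmetric]
      by (simp add: scale_right_distrib mult.commute)
    have "Tbar i (?a + scale p ?b) = scale p (?a + scale p ?b)"
      unfolding h.add h.scale Ta Tb by (simp add: algebra_simps)
    then show ?thesis unfolding gu h.scale by (simp add: mult.commute)
  qed
  then show ?thesis unfolding YL h.sum scale_sum_right by (intro sum.cong) auto
qed

text \<open>A reduced word of \<open>u\<close> avoids the letter \<open>k\<close>, so each of its
  \<open>inv_count n u\<close> letters contributes one factor \<open>p\<close>.\<close>

lemma perm_Tbar_Y_lambda:
  assumes la: "la \<in> young_box k n" and u: "u \<in> parabolic n k"
  shows "perm_op n Tbar u (YL la) = scale (p ^ inv_count n u) (YL la)"
proof -
  obtain ws where ws: "reduced_word n u ws" "perm_op n Tbar u = word_op Tbar ws"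
    by (rule perm_op_eq_word_op[OF parabolic_permutes[OF u]])
  have "word_op Tbar vs (YL la) = scale (p ^ length vs) (YL la)" if "set vs \<subseteq> {1..<n} - {k}" for vs
    using that
  proof (induction vs)
    case (Cons i vs)
    then have i: "i \<in> {1..<n}" "i \<noteq> k" by auto
    then show ?case
      using Cons module_hom.scale[OF Tbar_hom[OF i(1)]] Tbar_Y_lambda[OF la i] by (simp add: mult.commute)
  qed simp
  from this[of ws] show ?thesis
    using ws parabolic_reduced_word_notin[OF ws(1) u] by (auto simp: reduced_word_def)
qed

context
  assumes nz: "qfact p q k * qfact p q (n - k) \<noteq> 0"
begin

lemma Sigma_Y_lambda:
  assumes "la \<in> young_box k n"
  shows "Sigma_op scale p q n k T (YL la) = YL la"
proof -
  let ?d = "(k choose 2) + ((n - k) choose 2)"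
  have "(\<Sum>u\<in>parabolic n k. scale (q ^ (?d - inv_count n u)) (perm_op n Tbar u (YL la)))
    = (\<Sum>u\<in>parabolic n k. scale (q ^ (?d - inv_count n u) * p ^ inv_count n u) (YL la))"
    by (intro sum.cong refl) (simp only: perm_Tbar_Y_lambda[OF assms] scale_scale)
  also have "\<dots> = scale (qfact p q k * qfact p q (n - k)) (YL la)"
    by (simp only: scale_sum_left[symmetric] parabolic_poincare[OF kn])
  finally show ?thesis
    unfolding Sigma_op_def by (simp only: scale_scale left_inverse[OF nz] scale_one)
qed

lemma ev_Tbar_lambda_Y_lambda:
  assumes mu: "mu \<in> young_box k n" and nu: "nu \<in> young_box k n"
  shows "ev (Tbar_lambda scale p q n k T mu (YL nu)) = (if mu = nu then ev (Y id) else 0)"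
proof -
  let ?m = "grass_perm n k mu" and ?v = "grass_perm n k nu"
  interpret h: module_hom scale "(*)" "ev \<circ> perm_op n Tbar ?m"
    by (rule module_hom_compose[OF perm_Tbar_hom[OF grass_perm_permutes[OF mu kn]] ev_hom])
  have "ev (Tbar_lambda scale p q n k T mu (YL nu)) = (ev \<circ> perm_op n Tbar ?m) (YL nu)"
    by (simp add: Tbar_lambda_def Sigma_Y_lambda[OF nu])
  also have "\<dots> = (\<Sum>u\<in>parabolic n k. p ^ inv_count n u * ev (perm_op n Tbar ?m (Y (?v \<circ> u))))"
    unfolding Y_lambda_def h.sum h.scale by simp
  \<comment> \<open>Only \<open>u = id\<close> can survive, and its weight is
    \<open>p ^ 0 = 1\<close>.\<close>
  also have "\<dots> = (\<Sum>u\<in>parabolic n k. if u = id then if mu = nu then ev (Y id) else 0 else 0)"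
  proof (rule sum.cong[OF refl])
    fix u assume u: "u \<in> parabolic n k"
    have "ev (perm_op n Tbar ?m (Y (?v \<circ> u))) = (if ?m = ?v \<circ> u then ev (Y id) else 0)"
      by (intro ev_perm_Tbar_Y permutes_compose grass_perm_permutes mu nu kn parabolic_permutes[OF u])
    moreover have "?m = ?v \<circ> u \<longleftrightarrow> mu = nu \<and> u = id"
      using grass_perm_eq_comp_parabolic[OF mu nu kn u] by auto
    ultimately show "p ^ inv_count n u * ev (perm_op n Tbar ?m (Y (?v \<circ> u))) =
      (if u = id then if mu = nu then ev (Y id) else 0 else 0)" by simp
  qed
  finally show ?thesis by simp
qed

lemma ev_Tbar_lambda_hom:
  assumes la: "la \<in> young_box k n"
  shows "module_hom scale (*) (\<lambda>f. ev (Tbar_lambda scale p q n k T la f))"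
proof -
  interpret pair: module_pair scale scale ..
  have "module_hom scale scale (Sigma_op scale p q n k T)"
    unfolding Sigma_op_def
    by (intro pair.module_hom_scale pair.module_hom_sum perm_Tbar_hom parabolic_permutes)
      (auto simp: module_axioms)
  from module_hom_compose[OF this perm_Tbar_hom[OF grass_perm_permutes[OF la kn]]]
  have "module_hom scale scale (Tbar_lambda scale p q n k T la)"
    by (simp add: Tbar_lambda_def[abs_def] comp_def)
  from module_hom_compose[OF this ev_hom] show ?thesis by (simp add: comp_def)
qed

text \<open>Both sides are linear in \<open>f\<close>, so it suffices to compare them on the
  generators \<open>YL nu\<close>, where the duality leaves the single term
  \<open>la = nu\<close>.\<close>

lemma Y_lambda_expansion:
  assumes "f \<in> span (YL ` young_box k n)"
  shows "f = scale (inverse (ev (Y id)))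
    (\<Sum>la\<in>young_box k n. scale (ev (Tbar_lambda scale p q n k T la f)) (YL la))"
proof -
  interpret pair: module_pair scale scale ..
  let ?B = "young_box k n"
  let ?R = "\<lambda>f. scale (inverse (ev (Y id))) (\<Sum>la\<in>?B. scale (ev (Tbar_lambda scale p q n k T la f)) (YL la))"
  have "module_hom scale scale ?R"
    using ev_Tbar_lambda_hom
    by (intro pair.module_hom_scale pair.module_hom_sum) 
      (auto simp: module_hom_iff scale_left_distrib module_axioms)
  moreover have "YL nu = ?R (YL nu)" if nu: "nu \<in> ?B" for nu
  proof -
    have "(\<Sum>la\<in>?B. scale (ev (Tbar_lambda scale p q n k T la (YL nu))) (YL la))
      = (\<Sum>la\<in>?B. if la = nu then scale (ev (Y id)) (YL nu) else 0)"
      by (intro sum.cong refl) (simp add: ev_Tbar_lambda_Y_lambda nu)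
    also have "\<dots> = scale (ev (Y id)) (YL nu)"
      using nu finite_young_box[OF kn] by simp
    finally show ?thesis using ev_Y[OF permutes_id] by simp
  qed
  moreover have "module_hom scale scale (\<lambda>f. f)" by (simp add: module_hom_iff module_axioms)
  ultimately show ?thesis
    using pair.module_hom_eq_on_span[OF _ _ _ assms, of "\<lambda>f. f" ?R] by blast
qed

end

end

end

theorem theorem4p10:
  fixes scale :: "'f::field_char_0 \<Rightarrow> 'v \<Rightarrow> 'v::ab_group_add"
    and n k :: nat and p q hb :: 'f and t :: "nat \<Rightarrow> 'f"
    and T x :: "nat \<Rightarrow> 'v \<Rightarrow> 'v" and Y :: "(nat \<Rightarrow> nat) \<Rightarrow> 'v" and ev :: "'v \<Rightarrow> 'f"
  assumes rep: "schubert_rep scale n p q hb t T x Y ev"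
    and kn: "k \<le> n"
    and inv: "qfact p q k * qfact p q (n - k) \<noteq> 0"
  shows "(\<forall>mu\<in>young_box k n. \<forall>nu\<in>young_box k n.
            ev (Tbar_lambda scale p q n k T mu (Y_lambda scale p n k Y nu))
              = (if mu = nu then ev (Y id) else 0))
       \<and> (\<forall>f\<in>module.span scale (Y_lambda scale p n k Y ` young_box k n).
            f = scale (inverse (ev (Y id)))
                  (\<Sum>la\<in>young_box k n. scale (ev (Tbar_lambda scale p q n k T la f)) (Y_lambda scale p n k Y la)))"
proof -
  have vs: "vector_space scale"
    and T_lin: "\<forall>i\<in>{1..<n}. Vector_Spaces.linear scale scale (T i)"
    and quad: "\<forall>i\<in>{1..<n}. \<forall>v. T i (T i v) + scale (p - q) (T i v) - scale (p * q) v = 0"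
    and comm: "\<forall>i\<in>{1..<n}. \<forall>j\<in>{1..<n}. (i + 1 < j \<or> j + 1 < i) \<longrightarrow> (\<forall>v. T i (T j v) = T j (T i v))"
    and braid: "\<forall>i. 1 \<le> i \<and> i + 1 < n \<longrightarrow> (\<forall>v. T i (T (i+1) (T i v)) = T (i+1) (T i (T (i+1) v)))"
    and Y_eq: "\<forall>w. w permutes {1..n} \<longrightarrow> Y w = perm_op n T (inv w \<circ> w0 n) (Y (w0 n))"
    and ev_lin: "Vector_Spaces.linear scale (*) ev"
    and ev_Y: "\<forall>w. w permutes {1..n} \<longrightarrow> (ev (Y w) \<noteq> 0 \<longleftrightarrow> w = id)"
    using rep unfolding schubert_rep_def by - (elim conjE, assumption)+
  interpret schubert_action scale n p q T Y ev
  proof (intro schubert_action.intro schubert_action_axioms.intro vs)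
    show "module_hom scale scale (T i)" if "i \<in> {1..<n}" for i
      unfolding module_hom_iff_linear using bspec[OF T_lin that] .
    show "T i (T i v) + scale (p - q) (T i v) = scale (p * q) v" if "i \<in> {1..<n}" for i v
      using bspec[OF quad that, THEN spec, of v] by simp
    show "T i \<circ> T j = T j \<circ> T i" if "i \<in> {1..<n}" "j \<in> {1..<n}" "Suc i < j" for i j
      using bspec[OF bspec[OF comm that(1)] that(2)] that(3) by (intro ext) simp
    show "T i \<circ> (T (Suc i) \<circ> T i) = T (Suc i) \<circ> (T i \<circ> T (Suc i))" if "1 \<le> i" "Suc i < n" for i
      using braid[THEN spec, of i] that by (intro ext) simp
    show "module_hom scale (*) ev" unfolding module_hom_iff_linear by (rule ev_lin)
  qed (use Y_eq ev_Y in \<open>blast+\<close>)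
  show ?thesis
    by (intro conjI ballI ev_Tbar_lambda_Y_lambda Y_lambda_expansion kn inv)
qed

end
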